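(* Let $(S,\sim,\cdot)$ satisfy axioms A1–A7 (listed in the context), and let $\overrightarrow{S}$ be the set of vectors, i.e. of equivalence classes $\overrightarrow{AB}$ of pairs of points. Then for every point $A\in S$ the function $X\mapsto\overrightarrow{AX}$ is a bijection from the set of points $S$ onto the set of vectors $\overrightarrow{S}$.
   Context: $S$ is a non-empty set whose elements are called points. An ordered pair $(A,B)\in S^2$ is written $AB$ and called an arrow. The primitive notions are a binary relation $\sim$ on $S^2$ and a multiplication $\cdot:\mathbb{R}\times S^2\to S^2$, $(\lambda,AB)\mapsto\lambda\cdot AB$ (also written $\lambda AB$). Addition of arrows: $AB+BC=AC$; more generally $AB+CD=AB+BX=AX$, where $X$ is a point with $BX\sim CD$, provided such a point exists (it is then unique by A2). Axioms (for all points and all real $\lambda,\mu$): A1: $\sim$ is an equivalence relation on $S^2$. A2: $AB\sim AC\Rightarrow B=C$. A3.1: $AB\sim A'B'\Rightarrow BA\sim B'A'$. A3.2: $AB\sim A'B'$ and $BC\sim B'C'$ imply $AC\sim A'C'$. A4: for all $\lambda,A,B$ there is $C$ with $\lambda\cdot AB=AC$. A5: $AB\sim CD\Rightarrow\lambda AB\sim\lambda CD$. A6.1: $1\cdot AB=AB$. A6.2: $\lambda\cdot AB+\mu\cdot AB=(\lambda+\mu)\cdot AB$ (in particular the left side is defined). A6.3: $\lambda\cdot(\mu\cdot AB)=(\lambda\mu)\cdot AB$. A7: if $AC=\lambda\cdot AB$ and $AC'=\lambda\cdot AB'$, then $CC'\sim\lambda\cdot BB'$. Vectors: $\overrightarrow{AB}=\{CD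 : CD\sim AB\}$ is the $\sim$-class of $AB$, and $\overrightarrow{S}$ is the set of all these classes. *)

theory Defs
  imports Complex_Main
begin

text \<open>
  Arrows are pairs of points of the carrier \<open>S\<close>. The sum of \<open>(A, B)\<close> and \<open>(C, D)\<close> is
  \<open>(A, X)\<close> for the point \<open>X\<close> with \<open>(B, X)\<close> equivalent to \<open>(C, D)\<close>, and is undefined
  (\<open>None\<close>) if there is no such point. Axiom A2 below makes \<open>X\<close> unique, so that the definite
  description is meaningful.
\<close>

definition arrow_add ::
  "'a set \<Rightarrow> ('a \<times> 'a) rel \<Rightarrow> 'a \<times> 'a \<Rightarrow> 'a \<times> 'a \<Rightarrow> ('a \<times> 'a) option" where
  "arrow_add S sim p q =
     (if \<exists>X\<in>S. ((snd p, X), q) \<in> sim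
      then Some (fst p, THE X. X \<in> S \<and> ((snd p, X), q) \<in> sim)
      else None)"

text \<open>
  The typing of the multiplication as a map into \<open>S \<times> S\<close> is part of \<open>A4\<close>; its values on
  arguments outside \<open>S \<times> S\<close> are irrelevant.
\<close>

locale arrow_space =
  fixes S :: "'a set"
    and sim :: "('a \<times> 'a) rel"
    and mult :: "real \<Rightarrow> 'a \<times> 'a \<Rightarrow> 'a \<times> 'a"
  assumes nonempty: "S \<noteq> {}"
    and A1: "equiv (S \<times> S) sim"
    and A2: "\<lbrakk>A \<in> S; B \<in> S; C \<in> S; ((A, B), (A, C)) \<in> sim\<rbrakk> \<Longrightarrow> B = C"
    and A3_1: "\<lbrakk>A \<in> S; B \<in> S; A' \<in> S; B' \<in> S; ((A, B), (A', B')) \<in> sim\<rbrakk>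
                 \<Longrightarrow> ((B, A), (B', A')) \<in> sim"
    and A3_2: "\<lbrakk>A \<in> S; B \<in> S; C \<in> S; A' \<in> S; B' \<in> S; C' \<in> S;
                  ((A, B), (A', B')) \<in> sim; ((B, C), (B', C')) \<in> sim\<rbrakk>
                 \<Longrightarrow> ((A, C), (A', C')) \<in> sim"
    and A4: "\<lbrakk>A \<in> S; B \<in> S\<rbrakk> \<Longrightarrow> \<exists>C\<in>S. mult r (A, B) = (A, C)"
    and A5: "\<lbrakk>A \<in> S; B \<in> S; C \<in> S; D \<in> S; ((A, B), (C, D)) \<in> sim\<rbrakk>
               \<Longrightarrow> (mult r (A, B), mult r (C, D)) \<in> sim"
    and A6_1: "\<lbrakk>A \<in> S; B \<in> S\<rbrakk> \<Longrightarrow> mult 1 (A, B) = (A, B)"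
    and A6_2: "\<lbrakk>A \<in> S; B \<in> S\<rbrakk>
                 \<Longrightarrow> arrow_add S sim (mult r (A, B)) (mult t (A, B)) = Some (mult (r + t) (A, B))"
    and A6_3: "\<lbrakk>A \<in> S; B \<in> S\<rbrakk> \<Longrightarrow> mult r (mult t (A, B)) = mult (r * t) (A, B)"
    and A7: "\<lbrakk>A \<in> S; B \<in> S; B' \<in> S; C \<in> S; C' \<in> S;
                (A, C) = mult r (A, B); (A, C') = mult r (A, B')\<rbrakk>
               \<Longrightarrow> ((C, C'), mult r (B, B')) \<in> sim"

definition vec :: "('a \<times> 'a) rel \<Rightarrow> 'a \<Rightarrow> 'a \<Rightarrow> ('a \<times> 'a) set" where
  "vec sim A B = sim `` {(A, B)}"

definition vectors :: "'a set \<Rightarrow> ('a \<times> 'a) rel \<Rightarrow> ('a \<times> 'a) set set" where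
  "vectors S sim = (S \<times> S) // sim"

lemma (in arrow_space) vec_eq: "vec sim A B = {(C, D). ((C, D), (A, B)) \<in> sim}"
  using A1 by (auto simp: vec_def equiv_def dest: symD)

lemma vectors_eq: "vectors S sim = {vec sim A B | A B. A \<in> S \<and> B \<in> S}"
  by (auto simp: vectors_def vec_def quotient_def)

end

theory Submission
  imports Defs
begin

text \<open>
  Injectivity of \<open>X \<mapsto> vec A X\<close> is A2. Surjectivity says that every arrow \<open>CB\<close> can be
  transported to start at \<open>A\<close>, and this is done by a point reflection: if \<open>M\<close> is the midpoint
  of \<open>B\<close> and \<open>A\<close>, then the reflection in \<open>M\<close>, which is the multiplication by \<open>-1\<close> of the
  arrows from \<open>M\<close>, takes \<open>B\<close> to \<open>A\<close> and \<open>C\<close> to some point \<open>X\<close>. By A7 the arrow \<open>AX\<close> is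
  equivalent to \<open>-1 \<cdot> BC\<close>, hence to \<open>CB\<close>.

  The multiples that occur here are controlled by the distributive law A6.2: \<open>0 + 0 = 0\<close> shows
  that \<open>0 \<cdot> AB = AA\<close> (\<open>mult_zero\<close>), \<open>1 + (-1) = 0\<close> that \<open>-1 \<cdot> AB\<close> is equivalent to \<open>BA\<close>
  (\<open>mult_minus_one\<close>), and \<open>1/2 + 1/2 = 1\<close> that \<open>1/2 \<cdot> BA\<close> ends at a midpoint
  (\<open>midpoint_exists\<close>).
\<close>

context arrow_space
begin

lemma sim_sym: "(p, q) \<in> sim \<Longrightarrow> (q, p) \<in> sim"
  using A1 by (meson equivE symD)

lemma sim_trans: "(p, q) \<in> sim \<Longrightarrow> (q, r) \<in> sim \<Longrightarrow> (p, r) \<in> sim"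
  using A1 by (meson equivE transD)

lemma arrow_add_SomeD:
  assumes "arrow_add S sim (A, B) q = Some (A', X)" and "B \<in> S"
  shows "((B, X), q) \<in> sim"
proof -
  obtain Y where Y: "Y \<in> S" "((B, Y), q) \<in> sim"
    using assms(1) by (auto simp: arrow_add_def split: if_splits)
  have "(THE Z. Z \<in> S \<and> ((B, Z), q) \<in> sim) = Y"
  proof (rule the_equality)
    fix Z assume Z: "Z \<in> S \<and> ((B, Z), q) \<in> sim"
    then have "((B, Z), (B, Y)) \<in> sim"
      using sim_trans[OF _ sim_sym[OF Y(2)]] by blast
    then show "Z = Y" using A2[OF assms(2) _ Y(1)] Z by blast
  qed (use Y in blast)
  then show ?thesis
    using assms(1) Y by (auto simp: arrow_add_def split: if_splits)
qed

text \<open>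
  This form of A6.2 trades the partial addition, with its definite description, for an
  equivalence of arrows; it is what A2 and A3 can be applied to.
\<close>

lemma mult_add_sim:
  assumes "A \<in> S" "B \<in> S" "C \<in> S"
    and "mult r (A, B) = (A, C)" "mult (r + t) (A, B) = (A, D)"
  shows "((C, D), mult t (A, B)) \<in> sim"
  using A6_2[OF assms(1,2), of r t] assms arrow_add_SomeD by simp

text \<open>
  If \<open>C\<close> is the end of \<open>0 \<cdot> AB\<close>, then \<open>0 + 0 = 0\<close> makes \<open>CC\<close> equivalent to \<open>AC\<close>. Both
  arrows end at \<open>C\<close>, so A2 applies after they are reversed.
\<close>

lemma mult_zero:
  assumes "A \<in> S" "B \<in> S"
  shows "mult 0 (A, B) = (A, A)"
proof -
  obtain C where C: "C \<in> S" "mult 0 (A, B) = (A, C)"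
    using A4[OF assms(1,2)] by blast
  have "((C, C), (A, C)) \<in> sim"
    using mult_add_sim[of A B C 0 0 C] assms C by simp
  then have "((C, C), (C, A)) \<in> sim"
    using A3_1[of C C A C] C assms by simp
  then have "C = A" using A2[of C C A] C assms by simp
  with C show ?thesis by simp
qed

lemma mult_minus_one:
  assumes "A \<in> S" "B \<in> S"
  shows "((B, A), mult (-1) (A, B)) \<in> sim"
  using mult_add_sim[of A B B 1 "-1" A] A6_1 mult_zero assms by simp

lemma midpoint_exists:
  assumes "A \<in> S" "B \<in> S"
  obtains M where "M \<in> S" "((M, B), (A, M)) \<in> sim"
proof -
  obtain M where M: "M \<in> S" "mult (1/2) (A, B) = (A, M)"
    using A4[OF assms(1,2)] by blast
  have "((M, B), (A, M)) \<in> sim"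
    using mult_add_sim[of A B M "1/2" "1/2" B] A6_1 assms M by simp
  with M that show ?thesis by blast
qed

lemma reflect_in_midpoint:
  assumes "A \<in> S" "B \<in> S" "M \<in> S" and mid: "((M, B), (A, M)) \<in> sim"
  shows "mult (-1) (M, A) = (M, B)"
proof -
  obtain Y where Y: "Y \<in> S" "mult (-1) (M, A) = (M, Y)"
    using A4[OF assms(3,1)] by blast
  have "((A, M), (M, Y)) \<in> sim"
    using mult_minus_one[of M A] assms Y by simp
  then have "B = Y"
    using A2[of M B Y] sim_trans[OF mid] assms Y(1) by simp
  with Y show ?thesis by simp
qed

lemma arrow_transport:
  assumes "A \<in> S" "B \<in> S" "C \<in> S"
  obtains X where "X \<in> S" "((A, X), (C, B)) \<in> sim"
proof -
  obtain M where M: "M \<in> S" "((M, A), (B, M)) \<in> sim"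
    using midpoint_exists[OF assms(2,1)] .
  obtain X where X: "X \<in> S" "mult (-1) (M, C) = (M, X)"
    using A4[OF M(1) assms(3)] by blast
  have "((A, X), mult (-1) (B, C)) \<in> sim"
    using A7[of M B C A X "-1"] reflect_in_midpoint[of B A M] assms M X by simp
  then have "((A, X), (C, B)) \<in> sim"
    using sim_trans[OF _ sim_sym[OF mult_minus_one[of B C]]] assms by simp
  with X that show ?thesis by blast
qed

lemma vec_eq_iff:
  assumes "A \<in> S" "B \<in> S" "C \<in> S" "D \<in> S"
  shows "vec sim A B = vec sim C D \<longleftrightarrow> ((A, B), (C, D)) \<in> sim"
  unfolding vec_def using A1 assms by (intro eq_equiv_class_iff) auto

end

theorem theoremW1:
  fixes S :: "'a set"
    and sim :: "('a \<times> 'a) rel"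
    and mult :: "real \<Rightarrow> 'a \<times> 'a \<Rightarrow> 'a \<times> 'a"
  assumes "arrow_space S sim mult"
  shows "\<forall>A\<in>S. bij_betw (\<lambda>X. vec sim A X) S (vectors S sim)"
proof
  interpret arrow_space S sim mult by fact
  fix A assume A: "A \<in> S"
  show "bij_betw (\<lambda>X. vec sim A X) S (vectors S sim)"
    unfolding bij_betw_def
  proof
    show "inj_on (\<lambda>X. vec sim A X) S"
      using A A2[OF A] by (auto intro!: inj_onI simp: vec_eq_iff)
    have "vec sim C B \<in> (\<lambda>X. vec sim A X) ` S" if CB: "C \<in> S" "B \<in> S" for B C
    proof -
      obtain X where "X \<in> S" "((A, X), (C, B)) \<in> sim"
        using arrow_transport[OF A CB(2,1)] .
      then have "vec sim A X = vec sim C B"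
        using vec_eq_iff A CB by simp
      with \<open>X \<in> S\<close> show ?thesis by (metis imageI)
    qed
    then show "(\<lambda>X. vec sim A X) ` S = vectors S sim"
      using A by (auto simp: vectors_eq)
  qed
qed

end
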